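(* Consider the stochastic trust-region algorithm described in the context, with $q>1$. Suppose that: (a) there exists $\rho\in(0,1]$ such that $\|B_k\|\le\frac1\rho\frac{\|G_k\|}{\Delta_k}$ for every $k\in\mathbb{N}_0$; (b) for some $\varepsilon_q>0$ independent of $k$, for every $k$ and every $\alpha>0$, almost surely $$\mathbb{P}\left(|F_k-F_k^s-(f(X_k)-f(X_k+S_k))|\ge\alpha\|S_k\|^q\,\middle|\,\mathcal{F}_{k-1}\right)\le\frac{\varepsilon_q}{\alpha^{q/(q-1)}};$$ (c) $\displaystyle \theta>\frac{(\rho^q\tau_q^-+\tau_q^+)\,\varepsilon_q^{1/r(q)}}{\rho^q\tau_q^-}$, where $r(q)=\frac{q}{q-1}$. Then $\sum_{k\in\mathbb{N}_0}\mathbb{E}[\Delta_k^q]<\infty$.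
   Context: $f:\mathbb{R}^n\to\mathbb{R}$ is locally Lipschitz continuous (possibly non-smooth) with $\inf f=f^*\in\mathbb{R}$. Stochastic trust-region algorithm. Parameters: deterministic $x_0\in\mathbb{R}^n$, $\delta_0>0$, and $\theta>0$, $\tau\in(0,1)$, $\bar\tau\in[1,1+\tau]$, $q>1$. Set $X_0=x_0$, $\Delta_0=\delta_0$. For $k=0,1,\dots$: select a (random) vector $G_k\in\mathbb{R}^n$, $G_k\ne0$, and a (possibly random) symmetric matrix $B_k\in\mathbb{R}^{n\times n}$; compute $S_k\in\arg\min_{\|s\|\le\Delta_k}\,G_k^\top s+\frac12 s^\top B_ks$; compute random estimates $F_k$, $F_k^s$ of $f(X_k)$, $f(X_k+S_k)$; if $F_k-F_k^s\ge\theta\|S_k\|^q$ (successful iteration) set $X_{k+1}=X_k+S_k$, $\Delta_{k+1}=\bar\tau\Delta_k$; otherwise (unsuccessful iteration) set $X_{k+1}=X_k$, $\Delta_{k+1}=(1-\tau)\Delta_k$. $\mathcal{F}_{k-1}$ is the $\sigma$-algebra of events up to the generation of $B_k$ and $G_k$, i.e. generated by $(F_j,F_j^s)_{j=0}^{k-1}$ and $(G_j,B_j)_{j=0}^{k}$; the solution $S_k$ is computed from $G_k,B_k,\Delta_k$ so that it is $\mathcal{F}_{k-1}$-measurable. Constants: $\tau_q^+=(1+\tau)^q-1$, $\tau_q^-=1-(1-\tau)^q$. $\|B_k\|$ is the operator norm. *)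

theory Defs
  imports "HOL-Probability.Probability"
begin

text \<open>The library's notion is for parametrised families of maps; a single map is a constant family.\<close>

definition locally_lipschitz :: "('a::metric_space \<Rightarrow> 'b::metric_space) \<Rightarrow> bool" where
  "locally_lipschitz f \<longleftrightarrow> local_lipschitz (UNIV :: real set) UNIV (\<lambda>_. f)"

definition tr_model :: "real ^ 'n \<Rightarrow> real ^ 'n ^ 'n \<Rightarrow> real ^ 'n \<Rightarrow> real" where
  "tr_model g B s = g \<bullet> s + (1 / 2) * (s \<bullet> (B *v s))"

text \<open>
  \<open>tr_history M F Fs G B k\<close> is the sigma-algebra usually denoted by an index one smaller, F(k-1):
  it is generated by the estimates of the iterations before \<open>k\<close> and by the vectors and matrices of
  the iterations up to and including \<open>k\<close>. (The index is shifted so that it is a natural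
  number for the initial one as well.)
\<close>

definition tr_history ::
  "'w measure \<Rightarrow> (nat \<Rightarrow> 'w \<Rightarrow> real) \<Rightarrow> (nat \<Rightarrow> 'w \<Rightarrow> real) \<Rightarrow>
   (nat \<Rightarrow> 'w \<Rightarrow> real ^ 'n) \<Rightarrow> (nat \<Rightarrow> 'w \<Rightarrow> real ^ 'n ^ 'n) \<Rightarrow> nat \<Rightarrow> 'w measure" where
  "tr_history M F Fs G B k = sigma (space M)
     ((\<Union>j<k. sets (vimage_algebra (space M) (F j) borel) \<union>
             sets (vimage_algebra (space M) (Fs j) borel)) \<union>
      (\<Union>j\<le>k. sets (vimage_algebra (space M) (G j) borel) \<union>
             sets (vimage_algebra (space M) (B j) borel)))"

text \<open>
  \<open>\<tau>bar\<close> is the expansion factor of the radius, \<open>1 - \<tau>\<close> the contraction factor.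
  The estimates \<open>F k\<close> of \<open>f (X k)\<close> and \<open>Fs k\<close> of \<open>f (X k + S k)\<close> are here arbitrary random
  variables; their accuracy is the subject of separate hypotheses.
\<close>

locale stochastic_trust_region = prob_space M
  for M :: "'w measure" +
  fixes f :: "real ^ 'n \<Rightarrow> real"
    and x0 :: "real ^ 'n"
    and \<delta>0 \<theta> \<tau> \<tau>bar q :: real
    and X :: "nat \<Rightarrow> 'w \<Rightarrow> real ^ 'n"
    and \<Delta> :: "nat \<Rightarrow> 'w \<Rightarrow> real"
    and G :: "nat \<Rightarrow> 'w \<Rightarrow> real ^ 'n"
    and B :: "nat \<Rightarrow> 'w \<Rightarrow> real ^ 'n ^ 'n"
    and S :: "nat \<Rightarrow> 'w \<Rightarrow> real ^ 'n"
    and F Fs :: "nat \<Rightarrow> 'w \<Rightarrow> real"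
  assumes f_locally_lipschitz: "locally_lipschitz f"
    and f_bdd_below: "bdd_below (range f)"
    and \<delta>0_pos: "\<delta>0 > 0"
    and \<theta>_pos: "\<theta> > 0"
    and \<tau>_bounds: "0 < \<tau>" "\<tau> < 1"
    and \<tau>bar_bounds: "1 \<le> \<tau>bar" "\<tau>bar \<le> 1 + \<tau>"
    and q_gt_1: "q > 1"
    and G_measurable: "\<And>k. G k \<in> borel_measurable M"
    and B_measurable: "\<And>k. B k \<in> borel_measurable M"
    and F_measurable: "\<And>k. F k \<in> borel_measurable M"
    and Fs_measurable: "\<And>k. Fs k \<in> borel_measurable M"
    and S_measurable: "\<And>k. S k \<in> borel_measurable (tr_history M F Fs G B k)"
    and G_nonzero: "\<And>k \<omega>. \<omega> \<in> space M \<Longrightarrow> G k \<omega> \<noteq> 0"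
    and B_symmetric: "\<And>k \<omega>. \<omega> \<in> space M \<Longrightarrow> transpose (B k \<omega>) = B k \<omega>"
    and S_argmin: "\<And>k \<omega>. \<omega> \<in> space M \<Longrightarrow>
      is_arg_min (tr_model (G k \<omega>) (B k \<omega>)) (\<lambda>s. norm s \<le> \<Delta> k \<omega>) (S k \<omega>)"
    and X_0: "\<And>\<omega>. \<omega> \<in> space M \<Longrightarrow> X 0 \<omega> = x0"
    and \<Delta>_0: "\<And>\<omega>. \<omega> \<in> space M \<Longrightarrow> \<Delta> 0 \<omega> = \<delta>0"
    and X_Suc: "\<And>k \<omega>. \<omega> \<in> space M \<Longrightarrow> X (Suc k) \<omega> =
      (if F k \<omega> - Fs k \<omega> \<ge> \<theta> * norm (S k \<omega>) powr q then X k \<omega> + S k \<omega> else X k \<omega>)"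
    and \<Delta>_Suc: "\<And>k \<omega>. \<omega> \<in> space M \<Longrightarrow> \<Delta> (Suc k) \<omega> =
      (if F k \<omega> - Fs k \<omega> \<ge> \<theta> * norm (S k \<omega>) powr q then \<tau>bar * \<Delta> k \<omega> else (1 - \<tau>) * \<Delta> k \<omega>)"
begin

lemma subalgebra_tr_history: "subalgebra M (tr_history M F Fs G B k)"
proof -
  let ?gen = "(\<Union>j<k. sets (vimage_algebra (space M) (F j) borel) \<union>
             sets (vimage_algebra (space M) (Fs j) borel)) \<union>
      (\<Union>j\<le>k. sets (vimage_algebra (space M) (G j) borel) \<union>
             sets (vimage_algebra (space M) (B j) borel))"
  have gen: "?gen \<subseteq> sets M"
    using F_measurable Fs_measurable G_measurable B_measurable
    by (auto simp: sets_vimage_algebra2 intro: measurable_sets)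
  then have "?gen \<subseteq> Pow (space M)"
    using sets.space_closed by blast
  then have "sets (tr_history M F Fs G B k) = sigma_sets (space M) ?gen"
    by (simp add: tr_history_def)
  with sets.sigma_sets_subset[OF gen] show ?thesis
    unfolding subalgebra_def by (simp add: tr_history_def space_measure_of_conv)
qed

end

definition tau_plus :: "real \<Rightarrow> real \<Rightarrow> real" where
  "tau_plus \<tau> q = (1 + \<tau>) powr q - 1"

definition tau_minus :: "real \<Rightarrow> real \<Rightarrow> real" where
  "tau_minus \<tau> q = 1 - (1 - \<tau>) powr q"

end

theory Submission
  imports Defs
begin

text \<open>
  The proof exhibits \<open>\<nu> f(X\<^sub>k) + \<Delta>\<^sub>k\<^sup>q\<close>, for a suitable weight \<open>\<nu> > 0\<close>, as a Lyapunov function whose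
  expectation drops by at least \<open>c E[\<Delta>\<^sub>k\<^sup>q]\<close> in each iteration, for one \<open>c > 0\<close>. It is bounded below since
  \<open>f\<close> is, so the drops are summable.

  Put \<open>z = \<parallel>S\<^sub>k\<parallel>\<^sup>q\<close>, \<open>y = \<Delta>\<^sub>k\<^sup>q\<close> and \<open>a = \<epsilon>\<^bsup>1/r\<^esup>\<close> with \<open>r = q/(q - 1)\<close>. The bound on the matrices forces
  every step to be long, \<open>\<rho> \<Delta>\<^sub>k \<le> \<parallel>S\<^sub>k\<parallel> \<le> \<Delta>\<^sub>k\<close>: an interior minimizer solves \<open>G + B S = 0\<close>, which a small \<open>B\<close>
  allows only for large \<open>S\<close> (lemma \<open>tr_step_norm_ge\<close>). Hence \<open>z\<close> and \<open>y\<close> are comparable.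

  The true decrease \<open>g = f(X\<^sub>k) - f(X\<^sub>k + S\<^sub>k)\<close> offered by the step is already known given the past; write
  \<open>g = d z\<close>. Only the acceptance of the step is still random. With \<open>\<tau>\<^sup>+\<close>, \<open>\<tau>\<^sup>-\<close> for the
  two \<open>\<tau>\<close>-constants, accepting instead of rejecting changes the Lyapunov function by at most
  \<open>(\<tau>\<^sup>+ + \<tau>\<^sup>-) y - \<nu> g\<close>, and rejecting changes it by \<open>- \<tau>\<^sup>- y\<close>. So all that has to be shown is that the
  conditional acceptance probability \<open>p\<close> satisfies \<open>p ((\<tau>\<^sup>+ + \<tau>\<^sup>-) y - \<nu> g) \<le> (\<tau>\<^sup>- - c) y\<close>. A step that offers
  too little is accepted only if the estimates err by at least \<open>(\<theta> - d) z\<close>; the tail bound thus gives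
  \<open>p \<le> (a/(\<theta> - d))\<^sup>r \<le> a/(\<theta> - d)\<close> when \<open>\<theta> - d > a\<close> (lemma \<open>acceptance_prob_tail\<close>). For
  \<open>d \<ge> \<theta> - a\<close> the trivial \<open>p \<le> 1\<close> suffices. For smaller \<open>d\<close>, after inserting the tail bound, the inequality is affine in \<open>d\<close>, so it is enough to check it at \<open>d = 0\<close>, at \<open>d = \<theta> - a\<close>, and
  for the slope on negative \<open>d\<close> (lemma \<open>drift_le\<close>). The last two checks ask for
  \<open>\<tau>\<^sup>+ / (\<rho>\<^sup>q (\<theta> - a)) < \<nu> < \<tau>\<^sup>- / a\<close>, and this interval is nonempty precisely because of the lower bound
  imposed on \<open>\<theta>\<close> (lemma \<open>lyapunov_weight_exists\<close>).
\<close>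

section \<open>Length of the trust-region step\<close>

lemma tr_model_along_line:
  fixes g s v :: "real ^ 'n" and B :: "real ^ 'n ^ 'n"
  assumes "transpose B = B"
  shows "tr_model g B (s + t *\<^sub>R v) =
    tr_model g B s + t * ((g + B *v s) \<bullet> v) + t\<^sup>2 * (v \<bullet> (B *v v) / 2)"
proof -
  have "s \<bullet> (B *v v) = (B *v s) \<bullet> v"
    by (metis assms dot_lmul_matrix transpose_matrix_vector)
  then show ?thesis
    unfolding tr_model_def
    by (simp add: matrix_vector_right_distrib matrix_vector_mult_scaleR inner_add_left
        inner_add_right inner_commute algebra_simps power2_eq_square add_divide_distrib)
qed

lemma interior_minimizer_stationary:
  fixes g s :: "real ^ 'n" and B :: "real ^ 'n ^ 'n"
  assumes sym: "transpose B = B"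
    and min: "is_arg_min (tr_model g B) (\<lambda>s. norm s \<le> \<delta>) s"
    and interior: "norm s < \<delta>"
  shows "g + B *v s = 0"
proof (rule ccontr)
  \<comment> \<open>The slope of the model at \<open>s\<close> in the direction of its own gradient \<open>v\<close> is \<open>\<parallel>v\<parallel>\<^sup>2\<close>.\<close>
  define v where "v = g + B *v s"
  assume "g + B *v s \<noteq> 0"
  then have v: "v \<noteq> 0" by (simp add: v_def)
  define h where "h = (\<lambda>t::real. tr_model g B (s + t *\<^sub>R v))"
  have h: "h = (\<lambda>t. tr_model g B s + t * (v \<bullet> v) + t\<^sup>2 * (v \<bullet> (B *v v) / 2))"
    unfolding h_def tr_model_along_line[OF sym] v_def ..
  have "(h has_field_derivative v \<bullet> v) (at 0)"
    unfolding h by (auto intro!: derivative_eq_intros)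
  moreover have "0 < (\<delta> - norm s) / norm v" using interior v by simp
  moreover have "\<forall>t. \<bar>0 - t\<bar> < (\<delta> - norm s) / norm v \<longrightarrow> h 0 \<le> h t"
  proof (intro allI impI)
    fix t :: real assume "\<bar>0 - t\<bar> < (\<delta> - norm s) / norm v"
    then have "\<bar>t\<bar> * norm v < \<delta> - norm s" using v by (simp add: pos_less_divide_eq)
    then have "norm (s + t *\<^sub>R v) \<le> \<delta>"
      using norm_triangle_ineq[of s "t *\<^sub>R v"] by simp
    then show "h 0 \<le> h t"
      using min unfolding is_arg_min_linorder h_def by simp
  qed
  ultimately have "v \<bullet> v = 0" by (rule DERIV_local_min)
  with v show False by simp
qed

text \<open>
  A step on the boundary has length \<open>\<delta>\<close>. For an interior one, stationarity gives
  \<open>\<parallel>g\<parallel> = \<parallel>B s\<parallel> \<le> \<parallel>g\<parallel> \<parallel>s\<parallel> / (\<rho> \<delta>)\<close>.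
\<close>

lemma tr_step_norm_ge:
  fixes g s :: "real ^ 'n" and B :: "real ^ 'n ^ 'n"
  assumes sym: "transpose B = B"
    and min: "is_arg_min (tr_model g B) (\<lambda>s. norm s \<le> \<delta>) s"
    and g: "g \<noteq> 0" and \<delta>: "\<delta> > 0" and \<rho>: "0 < \<rho>" "\<rho> \<le> 1"
    and B: "onorm (\<lambda>v. B *v v) \<le> (1 / \<rho>) * (norm g / \<delta>)"
  shows "\<rho> * \<delta> \<le> norm s"
proof (cases "norm s < \<delta>")
  case False
  then show ?thesis using \<rho> \<delta> by (smt (verit) mult_left_le_one_le)
next
  case True
  have "g = - (B *v s)"
    using interior_minimizer_stationary[OF sym min True] by (simp add: eq_neg_iff_add_eq_0)
  then have "norm g = norm (B *v s)" by simp
  also have "\<dots> \<le> onorm (\<lambda>v. B *v v) * norm s"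
    using onorm[OF matrix_vector_mul_bounded_linear] .
  also have "\<dots> \<le> (1 / \<rho>) * (norm g / \<delta>) * norm s"
    using B by (rule mult_right_mono) simp
  finally have "norm g * (\<rho> * \<delta>) \<le> norm g * norm s"
    using \<rho> \<delta> by (simp add: field_simps)
  then show ?thesis using g by simp
qed

section \<open>Deterministic inequality for the drift\<close>

lemma affine_nonneg_between:
  fixes A B x x1 :: real
  assumes "0 \<le> A" "0 \<le> A + B * x1" "0 \<le> x" "x \<le> x1"
  shows "0 \<le> A + B * x"
proof (cases "B \<ge> 0")
  case True
  then show ?thesis using assms by simp
next
  case False
  then have "B * x1 \<le> B * x" using assms by (simp add: mult_left_mono_neg)
  then show ?thesis using assms by linarith
qed

text \<open>
  Here \<open>y\<close> stands for \<open>\<Delta>\<^sub>k\<^sup>q\<close>, \<open>z\<close> for \<open>\<parallel>S\<^sub>k\<parallel>\<^sup>q\<close>, \<open>r\<close> for \<open>\<rho>\<^sup>q\<close>, \<open>g\<close> for the true decrease of the objective and \<open>p\<close>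
  for the probability of acceptance; \<open>m\<close> is \<open>\<tau>\<^sup>-\<close> and \<open>T\<close> is \<open>\<tau>\<^sup>+ + \<tau>\<^sup>-\<close>. If \<open>g \<ge> (\<theta> - a) z\<close>, the decrease of
  \<open>f\<close> outweighs the growth of the radius even for \<open>p = 1\<close>. Otherwise \<open>p \<le> a z / (\<theta> z - g)\<close>, and
  the inequality cleared of denominators is affine in \<open>g\<close>. The three bounds on \<open>c\<close> are, in this order, its
  validity at \<open>g = (\<theta> - a) z\<close>, the sign of its slope for \<open>g < 0\<close>, and its validity at \<open>g = 0\<close>. Negative
  \<open>g\<close> needs its own argument: a bad step is harmful in proportion to \<open>z\<close>, which is
  then estimated by \<open>z \<le> y\<close> instead of \<open>r y \<le> z\<close>.
\<close>

lemma drift_le: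
  fixes p y z g T m c \<nu> a r \<theta> :: real
  assumes p: "0 \<le> p" "p \<le> 1"
    and tail: "a * z < \<theta> * z - g \<Longrightarrow> p * (\<theta> * z - g) \<le> a * z"
    and z: "0 < z" "r * y \<le> z" "z \<le> y"
    and a: "0 < a" "a < \<theta>" and \<nu>: "0 < \<nu>"
    and c: "c \<le> \<nu> * r * (\<theta> - a) - (T - m)" "c \<le> m - \<nu> * a" "c * \<theta> \<le> m * \<theta> - a * T"
  shows "p * (T * y - \<nu> * g) \<le> (m - c) * y"
proof -
  have y: "0 < y" using z by simp
  have mc: "0 < m - c"
    using c(2) mult_pos_pos[OF \<nu> a(1)] by linarith
  \<comment> \<open>Worst case of a step that meets the threshold \<open>(\<theta> - a) z\<close>, where \<open>p\<close> may equal 1.\<close>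
  have small: "T * y - \<nu> * ((\<theta> - a) * z) \<le> (m - c) * y"
  proof -
    have "\<nu> * (\<theta> - a) * (r * y) \<le> \<nu> * (\<theta> - a) * z"
      using \<nu> a z by (intro mult_left_mono) auto
    moreover have "c * y \<le> (\<nu> * r * (\<theta> - a) - (T - m)) * y"
      using c(1) y by (intro mult_right_mono) auto
    ultimately show ?thesis by (simp add: algebra_simps)
  qed
  show ?thesis
  proof (cases "(\<theta> - a) * z \<le> g")
    case True
    then have "\<nu> * ((\<theta> - a) * z) \<le> \<nu> * g" using \<nu> by simp
    then have W: "T * y - \<nu> * g \<le> (m - c) * y" using small by linarith
    have "0 \<le> (m - c) * y" using mc y by simp
    show ?thesis
    proof (cases "0 \<le> T * y - \<nu> * g")
      case True
      then show ?thesis using W p by (smt (verit) mult_left_le_one_le)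
    next
      case False
      then show ?thesis using \<open>0 \<le> (m - c) * y\<close> p
        by (smt (verit) mult_nonneg_nonpos)
    qed
  next
    case False
    define u where "u = \<theta> * z - g"
    have u: "a * z < u" using False by (simp add: u_def algebra_simps)
    then have u0: "0 < u" using a z by (smt (verit) mult_pos_pos)
    have pu: "p * u \<le> a * z" using tail u by (simp add: u_def)
    have at0: "0 \<le> (m - c) * y * (\<theta> * z) - a * z * (T * y)"
    proof -
      have "0 \<le> (y * z) * (m * \<theta> - a * T - c * \<theta>)" using c(3) y z by simp
      then show ?thesis by (simp add: algebra_simps)
    qed
    have "0 \<le> ((m - c) * y * (\<theta> * z) - a * z * (T * y)) + (a * z * \<nu> - (m - c) * y) * g"
    proof (cases "0 \<le> g")
      case True
      show ?thesis
      proof (rule affine_nonneg_between[OF at0 _ True])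
        have "0 \<le> a * z * ((m - c) * y - (T * y - \<nu> * ((\<theta> - a) * z)))"
          using small a z by simp
        then show "0 \<le> ((m - c) * y * (\<theta> * z) - a * z * (T * y)) +
            (a * z * \<nu> - (m - c) * y) * ((\<theta> - a) * z)"
          by (simp add: algebra_simps)
      qed (use False in simp)
    next
      case False
      have "a * \<nu> * z \<le> a * \<nu> * y" using a \<nu> z by simp
      also have "\<dots> \<le> (m - c) * y" using c(2) y by (intro mult_right_mono) (auto simp: mult.commute)
      finally have "0 \<le> (a * z * \<nu> - (m - c) * y) * g"
        using False by (intro mult_nonpos_nonpos) (auto simp: mult_ac)
      then show ?thesis using at0 by linarith
    qed
    then have key: "a * z * (T * y - \<nu> * g) \<le> (m - c) * y * u"
      by (simp add: u_def algebra_simps)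
    show ?thesis
    proof (cases "0 \<le> T * y - \<nu> * g")
      case True
      have "p * u * (T * y - \<nu> * g) \<le> a * z * (T * y - \<nu> * g)"
        using pu True by (rule mult_right_mono)
      also note key
      finally have "(p * (T * y - \<nu> * g)) * u \<le> ((m - c) * y) * u" by (simp add: mult_ac)
      then show ?thesis using u0 by simp
    next
      case False
      then show ?thesis using mc y p
        by (smt (verit) mult_nonneg_nonpos mult_pos_pos)
    qed
  qed
qed

text \<open>
  The hypothesis on \<open>\<theta>\<close> rearranges to \<open>(T - m) a < r m (\<theta> - a)\<close>, that is, to
  \<open>(T - m) / (r (\<theta> - a)) < m / a\<close>; any \<open>\<nu>\<close> strictly between makes the first two slacks positive. The
  third one, \<open>m \<theta> > a T\<close>, is the same inequality weakened by \<open>r \<le> 1\<close>.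
\<close>

lemma lyapunov_weight_exists:
  fixes r m T a \<theta> :: real
  assumes r: "0 < r" "r \<le> 1" and m: "0 < m" "m < T" and a: "0 < a"
    and \<theta>: "\<theta> > (r * m + (T - m)) * a / (r * m)"
  obtains \<nu> c where "0 < \<nu>" "0 < c" "a < \<theta>"
    "c \<le> \<nu> * r * (\<theta> - a) - (T - m)" "c \<le> m - \<nu> * a" "c * \<theta> \<le> m * \<theta> - a * T"
proof -
  have rm: "0 < r * m" using r m by simp
  have \<theta>': "(r * m + (T - m)) * a < \<theta> * (r * m)" using \<theta> rm by (simp add: pos_divide_less_eq)
  have key: "(T - m) * a < r * m * (\<theta> - a)"
    using \<theta>' by (simp add: algebra_simps)
  have "0 < (T - m) * a" using m a by simp
  with key have "0 < r * m * (\<theta> - a)" by linarith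
  then have a\<theta>: "a < \<theta>" using rm by (simp add: zero_less_mult_iff)
  have "(T - m) / (r * (\<theta> - a)) < m / a"
    using key r a a\<theta> by (simp add: divide_less_eq less_divide_eq mult_ac)
  then obtain \<nu> where \<nu>: "(T - m) / (r * (\<theta> - a)) < \<nu>" "\<nu> < m / a" using dense by blast
  have "0 < (T - m) / (r * (\<theta> - a))" using m r a\<theta> by simp
  then have \<nu>0: "0 < \<nu>" using \<nu> by linarith
  have 1: "0 < \<nu> * r * (\<theta> - a) - (T - m)"
    using \<nu>(1) r a\<theta> by (simp add: divide_less_eq mult_ac)
  have 2: "0 < m - \<nu> * a" using \<nu>(2) a by (simp add: less_divide_eq)
  have 3: "0 < m * \<theta> - a * T"
  proof -
    have "r * (m * (\<theta> - a)) \<le> 1 * (m * (\<theta> - a))"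
      using r m a\<theta> by (intro mult_right_mono) auto
    then show ?thesis using key by (simp add: algebra_simps)
  qed
  have \<theta>0: "0 < \<theta>" using a a\<theta> by simp
  define c where "c = min (\<nu> * r * (\<theta> - a) - (T - m)) (min (m - \<nu> * a) ((m * \<theta> - a * T) / \<theta>))"
  have "c \<le> (m * \<theta> - a * T) / \<theta>" unfolding c_def by linarith
  then have c3: "c * \<theta> \<le> m * \<theta> - a * T" using \<theta>0 by (simp add: pos_le_divide_eq)
  have "0 < (m * \<theta> - a * T) / \<theta>" using 3 \<theta>0 by simp
  then have "0 < c" using 1 2 by (simp add: c_def)
  moreover have "c \<le> \<nu> * r * (\<theta> - a) - (T - m)" "c \<le> m - \<nu> * a"
    unfolding c_def by linarith+
  ultimately show thesis using that \<nu>0 a\<theta> c3 by blast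
qed

text \<open>
  The left-hand side is \<open>(\<epsilon>\<^bsup>1/r\<^esup> / \<alpha>)\<^sup>r\<close>, a power of a number at most 1 with exponent at least 1. The linear
  tail is what makes the drift inequality affine.
\<close>

lemma powr_tail_le_linear_tail:
  fixes \<epsilon> \<alpha> r :: real
  assumes "0 < \<epsilon>" "1 \<le> r" "\<epsilon> powr (1 / r) \<le> \<alpha>"
  shows "\<epsilon> / \<alpha> powr r \<le> \<epsilon> powr (1 / r) / \<alpha>"
proof -
  define a where "a = \<epsilon> powr (1 / r)"
  have a: "0 < a" "a \<le> \<alpha>" using assms by (simp_all add: a_def)
  have "\<epsilon> = a powr r" using assms by (simp add: a_def powr_powr)
  then have "\<epsilon> / \<alpha> powr r = (a / \<alpha>) powr r" using a by (simp add: powr_divide)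
  also have "\<dots> \<le> (a / \<alpha>) powr 1" using a assms(2) by (intro powr_mono') auto
  finally show ?thesis using a by (simp add: a_def)
qed

lemma mult_le_of_rationals_below:
  fixes p t a :: real
  assumes "0 \<le> p" "0 < a" "a < t"
    and le: "\<And>\<alpha>. \<alpha> \<in> \<rat> \<Longrightarrow> a < \<alpha> \<Longrightarrow> \<alpha> \<le> t \<Longrightarrow> p \<le> a / \<alpha>"
  shows "p * t \<le> a"
proof (rule ccontr)
  assume *: "\<not> p * t \<le> a"
  then have p: "0 < p" using assms by (cases "p = 0") auto
  with * have "max a (a / p) < t" using assms by (simp add: divide_less_eq mult.commute)
  then obtain \<alpha> where \<alpha>: "\<alpha> \<in> \<rat>" "max a (a / p) < \<alpha>" "\<alpha> < t" using Rats_dense_in_real by blast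
  then have "p \<le> a / \<alpha>" by (intro le) auto
  moreover have "0 < \<alpha>" "a / p < \<alpha>" using \<alpha> assms by auto
  ultimately show False using p by (simp add: field_simps)
qed

section \<open>Pathwise bounds and measurability of the iterates\<close>

context stochastic_trust_region
begin

abbreviation past :: "nat \<Rightarrow> 'w measure" where
  "past k \<equiv> tr_history M F Fs G B k"

definition accepted :: "nat \<Rightarrow> 'w set" where
  "accepted k = {\<omega> \<in> space M. F k \<omega> - Fs k \<omega> \<ge> \<theta> * norm (S k \<omega>) powr q}"

definition gain :: "nat \<Rightarrow> 'w \<Rightarrow> real" where
  "gain k \<omega> = f (X k \<omega>) - f (X k \<omega> + S k \<omega>)"

lemma continuous_f: "continuous_on UNIV f"
  using local_lipschitz_continuous_on[OF f_locally_lipschitz[unfolded locally_lipschitz_def]]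
  by simp

lemma measurable_f [measurable]: "f \<in> borel_measurable borel"
  using continuous_f by (rule borel_measurable_continuous_onI)

lemma space_past [simp]: "space (past k) = space M"
  using subalgebra_tr_history[of k] by (simp add: subalgebra_def)

lemma past_mono: "j \<le> k \<Longrightarrow> sets (past j) \<subseteq> sets (past k)"
proof -
  assume "j \<le> k"
  define gen where "gen = (\<lambda>k. (\<Union>j<k. sets (vimage_algebra (space M) (F j) borel) \<union>
             sets (vimage_algebra (space M) (Fs j) borel)) \<union>
      (\<Union>j\<le>k. sets (vimage_algebra (space M) (G j) borel) \<union>
             sets (vimage_algebra (space M) (B j) borel)))"
  have "sets (past i) = sigma_sets (space M) (gen i)" for i
  proof -
    have "gen i \<subseteq> Pow (space M)" by (auto simp: gen_def sets_vimage_algebra2)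
    then show ?thesis by (simp add: tr_history_def gen_def sets_measure_of)
  qed
  moreover have "gen j \<subseteq> gen k"
    unfolding gen_def using \<open>j \<le> k\<close>
    by (intro Un_mono UN_mono) auto
  ultimately show "sets (past j) \<subseteq> sets (past k)" by (simp add: sigma_sets_mono')
qed

lemma measurable_past_mono:
  "j \<le> k \<Longrightarrow> h \<in> borel_measurable (past j) \<Longrightarrow> h \<in> borel_measurable (past k)"
  by (rule measurable_from_subalg[of "past k" "past j"])
    (simp_all add: subalgebra_def past_mono)

lemma measurable_past_estimates:
  assumes "j < k"
  shows "F j \<in> borel_measurable (past k)" "Fs j \<in> borel_measurable (past k)"
proof -
  let ?gen = "(\<Union>j<k. sets (vimage_algebra (space M) (F j) borel) \<union>
             sets (vimage_algebra (space M) (Fs j) borel)) \<union>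
      (\<Union>j\<le>k. sets (vimage_algebra (space M) (G j) borel) \<union>
             sets (vimage_algebra (space M) (B j) borel))"
  have "?gen \<subseteq> Pow (space M)" by (auto simp: sets_vimage_algebra2)
  then have "?gen \<subseteq> sets (past k)" unfolding tr_history_def by (auto simp: sets_measure_of)
  then have *: "sets (vimage_algebra (space M) (F j) borel) \<subseteq> sets (past k)"
      "sets (vimage_algebra (space M) (Fs j) borel) \<subseteq> sets (past k)"
    using assms by blast+
  show "F j \<in> borel_measurable (past k)" "Fs j \<in> borel_measurable (past k)"
    using * in_vimage_algebra[of _ borel "F j" "space M"] in_vimage_algebra[of _ borel "Fs j" "space M"]
    by (auto intro!: measurableI)
qed

text \<open>
  The step \<open>S k\<close> depends on \<open>past k\<close>, but the decision about it depends on the estimates of iteration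
  \<open>k\<close>, which enter the history only at \<open>k + 1\<close>. This is just in time for \<open>X (Suc k)\<close> and \<open>\<Delta> (Suc k)\<close>.
\<close>

lemma measurable_past_iterates:
  shows "X k \<in> borel_measurable (past k) \<and> \<Delta> k \<in> borel_measurable (past k)"
proof (induction k)
  case 0
  have "X 0 \<in> borel_measurable (past 0) \<longleftrightarrow> (\<lambda>_. x0) \<in> borel_measurable (past 0)"
    by (rule measurable_cong) (simp add: X_0)
  moreover have "\<Delta> 0 \<in> borel_measurable (past 0) \<longleftrightarrow> (\<lambda>_. \<delta>0) \<in> borel_measurable (past 0)"
    by (rule measurable_cong) (simp add: \<Delta>_0)
  ultimately show ?case by simp
next
  case (Suc k)
  have [measurable]: "X k \<in> borel_measurable (past (Suc k))" "\<Delta> k \<in> borel_measurable (past (Suc k))"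
    "S k \<in> borel_measurable (past (Suc k))"
    using Suc S_measurable by (auto intro: measurable_past_mono[of k "Suc k"])
  have [measurable]: "F k \<in> borel_measurable (past (Suc k))"
    "Fs k \<in> borel_measurable (past (Suc k))"
    by (simp_all add: measurable_past_estimates)
  have "X (Suc k) \<in> borel_measurable (past (Suc k)) \<longleftrightarrow>
    (\<lambda>\<omega>. if F k \<omega> - Fs k \<omega> \<ge> \<theta> * norm (S k \<omega>) powr q then X k \<omega> + S k \<omega> else X k \<omega>)
      \<in> borel_measurable (past (Suc k))"
    by (rule measurable_cong) (simp add: X_Suc)
  moreover have "\<Delta> (Suc k) \<in> borel_measurable (past (Suc k)) \<longleftrightarrow>
    (\<lambda>\<omega>. if F k \<omega> - Fs k \<omega> \<ge> \<theta> * norm (S k \<omega>) powr q then \<tau>bar * \<Delta> k \<omega> else (1 - \<tau>) * \<Delta> k \<omega>)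
      \<in> borel_measurable (past (Suc k))"
    by (rule measurable_cong) (simp add: \<Delta>_Suc)
  moreover have "(\<lambda>\<omega>. if F k \<omega> - Fs k \<omega> \<ge> \<theta> * norm (S k \<omega>) powr q then X k \<omega> + S k \<omega> else X k \<omega>)
      \<in> borel_measurable (past (Suc k))" by measurable
  moreover have "(\<lambda>\<omega>. if F k \<omega> - Fs k \<omega> \<ge> \<theta> * norm (S k \<omega>) powr q then \<tau>bar * \<Delta> k \<omega>
      else (1 - \<tau>) * \<Delta> k \<omega>) \<in> borel_measurable (past (Suc k))" by measurable
  ultimately show ?case by blast
qed

lemmas measurable_from_past = measurable_from_subalg[OF subalgebra_tr_history]

lemma measurable_iterates [measurable]:
  "X k \<in> borel_measurable M" "\<Delta> k \<in> borel_measurable M" "S k \<in> borel_measurable M"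
  "F k \<in> borel_measurable M" "Fs k \<in> borel_measurable M"
  using measurable_from_past[OF conjunct1[OF measurable_past_iterates]]
    measurable_from_past[OF conjunct2[OF measurable_past_iterates]]
    measurable_from_past[OF S_measurable] F_measurable Fs_measurable
  by blast+

lemma accepted_sets [measurable]: "accepted k \<in> sets M"
  unfolding accepted_def by measurable

lemma gain_measurable_past: "gain k \<in> borel_measurable (past k)"
proof -
  have [measurable]: "X k \<in> borel_measurable (past k)" "S k \<in> borel_measurable (past k)"
    using measurable_past_iterates S_measurable by auto
  show ?thesis unfolding gain_def by measurable
qed

lemma gain_measurable [measurable]: "gain k \<in> borel_measurable M"
  using gain_measurable_past by (rule measurable_from_past)

lemma radius_bounds:
  assumes "\<omega> \<in> space M"
  shows "0 < \<Delta> k \<omega>" "\<Delta> k \<omega> \<le> (1 + \<tau>) ^ k * \<delta>0"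
proof -
  have "0 < \<Delta> k \<omega> \<and> \<Delta> k \<omega> \<le> (1 + \<tau>) ^ k * \<delta>0"
  proof (induction k)
    case 0
    then show ?case using assms \<delta>0_pos by (simp add: \<Delta>_0)
  next
    case (Suc k)
    define b where "b = (if F k \<omega> - Fs k \<omega> \<ge> \<theta> * norm (S k \<omega>) powr q then \<tau>bar else 1 - \<tau>)"
    have b: "0 < b" "b \<le> 1 + \<tau>" using \<tau>_bounds \<tau>bar_bounds by (auto simp: b_def)
    have "\<Delta> (Suc k) \<omega> = b * \<Delta> k \<omega>" using assms by (simp add: \<Delta>_Suc b_def)
    moreover have "b * \<Delta> k \<omega> \<le> (1 + \<tau>) * ((1 + \<tau>) ^ k * \<delta>0)"
      using b Suc by (intro mult_mono) auto
    ultimately show ?case using b Suc by (simp add: mult_ac)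
  qed
  then show "0 < \<Delta> k \<omega>" "\<Delta> k \<omega> \<le> (1 + \<tau>) ^ k * \<delta>0" by auto
qed

lemma step_norm_le: "\<omega> \<in> space M \<Longrightarrow> norm (S k \<omega>) \<le> \<Delta> k \<omega>"
  using S_argmin[of \<omega> k] by (simp add: is_arg_min_def)

text \<open>
  The start is deterministic and the radius grows at most geometrically, so each \<open>X k\<close> has values in a
  ball that depends on \<open>k\<close> only. Continuity of \<open>f\<close> on this ball yields the integrability of
  \<open>f (X k)\<close>.
\<close>

lemma iterate_bounded: "\<exists>R. \<forall>\<omega>\<in>space M. norm (X k \<omega>) \<le> R"
proof (induction k)
  case 0
  then show ?case by (auto simp: X_0)
next
  case (Suc k)
  then obtain R where R: "\<And>\<omega>. \<omega> \<in> space M \<Longrightarrow> norm (X k \<omega>) \<le> R" by blast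
  have "norm (X (Suc k) \<omega>) \<le> R + (1 + \<tau>) ^ k * \<delta>0" if "\<omega> \<in> space M" for \<omega>
    using R[OF that] step_norm_le[OF that, of k] radius_bounds[OF that, of k]
      norm_triangle_ineq[of "X k \<omega>" "S k \<omega>"]
    by (auto simp: X_Suc[OF that])
  then show ?case by blast
qed

lemma objective_bounded:
  "\<exists>C. \<forall>\<omega>\<in>space M. \<bar>f (X k \<omega>)\<bar> \<le> C \<and> \<bar>f (X k \<omega> + S k \<omega>)\<bar> \<le> C"
proof -
  obtain R where R: "\<And>\<omega>. \<omega> \<in> space M \<Longrightarrow> norm (X k \<omega>) \<le> R" using iterate_bounded by blast
  define R' where "R' = R + (1 + \<tau>) ^ k * \<delta>0"
  have "compact (f ` cball 0 R')"
    using continuous_f by (intro compact_continuous_image) (auto intro: continuous_on_subset)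
  then obtain C where C: "\<And>x. norm x \<le> R' \<Longrightarrow> \<bar>f x\<bar> \<le> C"
    using compact_imp_bounded bounded_iff by (metis image_eqI mem_cball_0 real_norm_def)
  have "norm (X k \<omega>) \<le> R'" "norm (X k \<omega> + S k \<omega>) \<le> R'" if "\<omega> \<in> space M" for \<omega>
    using R[OF that] step_norm_le[OF that, of k] radius_bounds[OF that, of k]
      norm_triangle_ineq[of "X k \<omega>" "S k \<omega>"] by (auto simp: R'_def)
  then show ?thesis using C by blast
qed

lemma integrable_objective: "integrable M (\<lambda>\<omega>. f (X k \<omega>))"
proof -
  obtain C where "\<forall>\<omega>\<in>space M. \<bar>f (X k \<omega>)\<bar> \<le> C" using objective_bounded[of k] by blast
  then show ?thesis by (intro integrable_const_bound[where B = C]) auto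
qed

lemma integrable_gain: "integrable M (gain k)"
proof -
  obtain C where C: "\<forall>\<omega>\<in>space M. \<bar>f (X k \<omega>)\<bar> \<le> C \<and> \<bar>f (X k \<omega> + S k \<omega>)\<bar> \<le> C"
    using objective_bounded[of k] ..
  have "\<bar>gain k \<omega>\<bar> \<le> 2 * C" if "\<omega> \<in> space M" for \<omega>
  proof -
    have "\<bar>f (X k \<omega>)\<bar> \<le> C" "\<bar>f (X k \<omega> + S k \<omega>)\<bar> \<le> C" using C that by blast+
    then show ?thesis unfolding gain_def by linarith
  qed
  then have "AE \<omega> in M. norm (gain k \<omega>) \<le> 2 * C" by (intro AE_I2) simp
  then show ?thesis using gain_measurable by (rule integrable_const_bound)
qed

lemma integrable_radius_powr: "integrable M (\<lambda>\<omega>. \<Delta> k \<omega> powr q)"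
proof (rule integrable_const_bound[where B = "((1 + \<tau>) ^ k * \<delta>0) powr q"])
  have "\<Delta> k \<omega> powr q \<le> ((1 + \<tau>) ^ k * \<delta>0) powr q" if "\<omega> \<in> space M" for \<omega>
    using radius_bounds[OF that, of k] q_gt_1 by (intro powr_mono2) simp_all
  then show "AE \<omega> in M. norm (\<Delta> k \<omega> powr q) \<le> ((1 + \<tau>) ^ k * \<delta>0) powr q"
    by (intro AE_I2) simp
qed measurable

section \<open>Conditional probability of acceptance and expected decrease\<close>

abbreviation acceptance_prob :: "nat \<Rightarrow> 'w \<Rightarrow> real" where
  "acceptance_prob k \<equiv> real_cond_exp M (past k) (indicat_real (accepted k))"

lemma finite_measure_subalgebra_past: "finite_measure_subalgebra M (past k)"
  by (intro finite_measure_subalgebra.intro finite_measure_subalgebra_axioms.intro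
      finite_measure_axioms subalgebra_tr_history)

lemma acceptance_prob_bounds:
  "AE \<omega> in M. 0 \<le> acceptance_prob k \<omega> \<and> acceptance_prob k \<omega> \<le> 1"
proof -
  interpret H: finite_measure_subalgebra M "past k" by (rule finite_measure_subalgebra_past)
  have int: "integrable M (indicat_real (accepted k))"
    by (rule integrable_const_bound[where B = 1]) (auto simp: indicator_def)
  have "AE \<omega> in M. 0 \<le> acceptance_prob k \<omega>"
    by (rule H.real_cond_exp_ge_c[OF int]) (simp add: indicator_def)
  moreover have "AE \<omega> in M. acceptance_prob k \<omega> \<le> 1"
    by (rule H.real_cond_exp_le_c[OF int]) (simp add: indicator_def)
  ultimately show ?thesis by eventually_elim simp
qed

definition deviation :: "nat \<Rightarrow> real \<Rightarrow> 'w set" where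
  "deviation k \<alpha> = {\<omega> \<in> space M.
    \<bar>F k \<omega> - Fs k \<omega> - (f (X k \<omega>) - f (X k \<omega> + S k \<omega>))\<bar> \<ge> \<alpha> * norm (S k \<omega>) powr q}"

lemma deviation_sets [measurable]: "deviation k \<alpha> \<in> sets M"
  unfolding deviation_def by measurable

text \<open>
  If the true decrease falls short of the threshold \<open>\<theta> \<parallel>S\<parallel>\<^sup>q\<close> by \<open>\<alpha> \<parallel>S\<parallel>\<^sup>q\<close>, only an error of at least
  this size can lead to acceptance. Whether it falls short is decided by the past, so the
  inclusion of events, valid on that set only, passes to conditional probabilities there.
\<close>

lemma acceptance_prob_le_deviation_prob:
  "AE \<omega> in M. gain k \<omega> \<le> (\<theta> - \<alpha>) * norm (S k \<omega>) powr q \<longrightarrow>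
     acceptance_prob k \<omega> \<le> real_cond_exp M (past k) (indicat_real (deviation k \<alpha>)) \<omega>"
proof -
  interpret H: finite_measure_subalgebra M "past k" by (rule finite_measure_subalgebra_past)
  define C where "C = {\<omega> \<in> space (past k). gain k \<omega> \<le> (\<theta> - \<alpha>) * norm (S k \<omega>) powr q}"
  have [measurable]: "gain k \<in> borel_measurable (past k)" "S k \<in> borel_measurable (past k)"
    using gain_measurable_past S_measurable by auto
  have C: "C \<in> sets (past k)" unfolding C_def by measurable
  then have CM [measurable]: "C \<in> sets M"
    using subalgebra_tr_history[of k] by (auto simp: subalgebra_def)
  have int: "integrable M (\<lambda>\<omega>. indicat_real C \<omega> * indicat_real (accepted k) \<omega>)"
    by (rule integrable_const_bound[where B = 1]) (auto simp: indicator_def)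
  have le: "AE \<omega> in M. indicat_real C \<omega> * indicat_real (accepted k) \<omega> \<le> indicat_real (deviation k \<alpha>) \<omega>"
    by (auto simp: C_def accepted_def deviation_def gain_def indicator_def algebra_simps)
  have "AE \<omega> in M. real_cond_exp M (past k) (\<lambda>\<omega>. indicat_real C \<omega> * indicat_real (accepted k) \<omega>) \<omega>
      \<le> real_cond_exp M (past k) (indicat_real (deviation k \<alpha>)) \<omega>"
    using le int
    by (rule H.real_cond_exp_mono)
      (rule integrable_const_bound[where B = 1], auto simp: indicator_def)
  moreover have "AE \<omega> in M. real_cond_exp M (past k)
      (\<lambda>\<omega>. indicat_real C \<omega> * indicat_real (accepted k) \<omega>) \<omega> = indicat_real C \<omega> * acceptance_prob k \<omega>"
    using C int by (intro H.real_cond_exp_mult) auto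
  ultimately show ?thesis
    using AE_space by eventually_elim (auto simp: C_def indicator_def)
qed

text \<open>
  The level at which the tail bound is needed is the random number
  \<open>\<theta> - gain k \<omega> / \<parallel>S k \<omega>\<parallel>\<^sup>q\<close>, while \<open>dev\<close> has an exceptional null set for each deterministic level. These
  null sets are collected over the rational levels, and the random one is approached by rationals from
  below.
\<close>

lemma acceptance_prob_tail:
  assumes a: "0 < a" and S: "\<And>\<omega>. \<omega> \<in> space M \<Longrightarrow> S k \<omega> \<noteq> 0"
    and dev: "\<And>\<alpha>. a < \<alpha> \<Longrightarrow>
      AE \<omega> in M. real_cond_exp M (past k) (indicat_real (deviation k \<alpha>)) \<omega> \<le> a / \<alpha>"
  shows "AE \<omega> in M. a * norm (S k \<omega>) powr q < \<theta> * norm (S k \<omega>) powr q - gain k \<omega> \<longrightarrow>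
    acceptance_prob k \<omega> * (\<theta> * norm (S k \<omega>) powr q - gain k \<omega>) \<le> a * norm (S k \<omega>) powr q"
proof -
  have "AE \<omega> in M. \<forall>\<alpha>\<in>\<rat> \<inter> {a<..}.
      gain k \<omega> \<le> (\<theta> - \<alpha>) * norm (S k \<omega>) powr q \<longrightarrow> acceptance_prob k \<omega> \<le> a / \<alpha>"
  proof (subst AE_ball_countable)
    show "countable (\<rat> \<inter> {a<..})" using countable_rat by blast
    show "\<forall>\<alpha>\<in>\<rat> \<inter> {a<..}. AE \<omega> in M.
      gain k \<omega> \<le> (\<theta> - \<alpha>) * norm (S k \<omega>) powr q \<longrightarrow> acceptance_prob k \<omega> \<le> a / \<alpha>"
    proof
      fix \<alpha> assume "\<alpha> \<in> \<rat> \<inter> {a<..}"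
      then show "AE \<omega> in M. gain k \<omega> \<le> (\<theta> - \<alpha>) * norm (S k \<omega>) powr q \<longrightarrow> acceptance_prob k \<omega> \<le> a / \<alpha>"
        using dev[of \<alpha>] acceptance_prob_le_deviation_prob[of k \<alpha>] by auto
    qed
  qed
  then show ?thesis using acceptance_prob_bounds[of k] AE_space
  proof eventually_elim
    case (elim \<omega>)
    define z where "z = norm (S k \<omega>) powr q"
    define t where "t = \<theta> - gain k \<omega> / z"
    have z: "0 < z" using S elim by (simp add: z_def)
    have tz: "\<theta> * z - gain k \<omega> = t * z" using z by (simp add: t_def field_simps)
    have "acceptance_prob k \<omega> * t \<le> a" if "a < t"
    proof (rule mult_le_of_rationals_below[OF _ a that])
      fix \<alpha> assume \<alpha>: "\<alpha> \<in> \<rat>" "a < \<alpha>" "\<alpha> \<le> t"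
      have "\<alpha> * z \<le> t * z" using \<alpha> z by simp
      then have "gain k \<omega> \<le> (\<theta> - \<alpha>) * z" using tz by (simp add: algebra_simps)
      then show "acceptance_prob k \<omega> \<le> a / \<alpha>" using elim(1) \<alpha> by (auto simp: z_def)
    qed (use elim in auto)
    then show ?case
      unfolding z_def[symmetric] tz using z by (auto simp: mult.assoc[symmetric] intro!: mult_right_mono)
  qed
qed

lemma lyapunov_pathwise:
  assumes \<omega>: "\<omega> \<in> space M" and \<nu>: "0 \<le> \<nu>"
  shows "\<nu> * f (X (Suc k) \<omega>) + \<Delta> (Suc k) \<omega> powr q \<le> \<nu> * f (X k \<omega>) + \<Delta> k \<omega> powr q
    + indicat_real (accepted k) \<omega> * ((tau_plus \<tau> q + tau_minus \<tau> q) * \<Delta> k \<omega> powr q - \<nu> * gain k \<omega>)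
    - tau_minus \<tau> q * \<Delta> k \<omega> powr q"
proof (cases "\<omega> \<in> accepted k")
  case True
  have "(\<tau>bar * \<Delta> k \<omega>) powr q = \<tau>bar powr q * \<Delta> k \<omega> powr q"
    using \<tau>bar_bounds radius_bounds[OF \<omega>, of k] by (simp add: powr_mult)
  also have "\<dots> \<le> (1 + \<tau>) powr q * \<Delta> k \<omega> powr q"
    using \<tau>bar_bounds q_gt_1 by (intro mult_right_mono powr_mono2) auto
  finally show ?thesis
    using True \<omega> by (simp add: accepted_def X_Suc \<Delta>_Suc gain_def tau_plus_def tau_minus_def algebra_simps)
next
  case False
  have "((1 - \<tau>) * \<Delta> k \<omega>) powr q = (1 - \<tau>) powr q * \<Delta> k \<omega> powr q"
    using \<tau>_bounds radius_bounds[OF \<omega>, of k] by (simp add: powr_mult)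
  then show ?thesis
    using False \<omega> by (simp add: accepted_def X_Suc \<Delta>_Suc tau_minus_def algebra_simps)
qed

text \<open>
  The pathwise bound is integrated with the indicator of acceptance replaced by its conditional
  probability. This is legitimate because its factor \<open>W\<close> is measurable with respect to the past.
\<close>

lemma lyapunov_expected_decrease:
  assumes \<rho>: "0 < \<rho>"
    and S: "\<And>\<omega>. \<omega> \<in> space M \<Longrightarrow> \<rho> * \<Delta> k \<omega> \<le> norm (S k \<omega>)"
    and dev: "\<And>\<alpha>. a < \<alpha> \<Longrightarrow>
      AE \<omega> in M. real_cond_exp M (past k) (indicat_real (deviation k \<alpha>)) \<omega> \<le> a / \<alpha>"
    and a: "0 < a" "a < \<theta>" and \<nu>: "0 < \<nu>"
    and c: "c \<le> \<nu> * \<rho> powr q * (\<theta> - a) - tau_plus \<tau> q" "c \<le> tau_minus \<tau> q - \<nu> * a"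
      "c * \<theta> \<le> tau_minus \<tau> q * \<theta> - a * (tau_plus \<tau> q + tau_minus \<tau> q)"
  shows "\<nu> * expectation (\<lambda>\<omega>. f (X (Suc k) \<omega>)) + expectation (\<lambda>\<omega>. \<Delta> (Suc k) \<omega> powr q)
    \<le> \<nu> * expectation (\<lambda>\<omega>. f (X k \<omega>)) + expectation (\<lambda>\<omega>. \<Delta> k \<omega> powr q)
      - c * expectation (\<lambda>\<omega>. \<Delta> k \<omega> powr q)"
proof -
  interpret H: finite_measure_subalgebra M "past k" by (rule finite_measure_subalgebra_past)
  define T where "T = tau_plus \<tau> q + tau_minus \<tau> q"
  define m where "m = tau_minus \<tau> q"
  define y where "y = (\<lambda>\<omega>. \<Delta> k \<omega> powr q)"
  define W where "W = (\<lambda>\<omega>. T * y \<omega> - \<nu> * gain k \<omega>)"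
  note int = integrable_objective integrable_radius_powr
  have y_int: "integrable M y" unfolding y_def by (rule integrable_radius_powr)
  have W_int: "integrable M W" unfolding W_def using y_int integrable_gain by auto
  have W_past: "W \<in> borel_measurable (past k)"
  proof -
    have [measurable]: "gain k \<in> borel_measurable (past k)" "\<Delta> k \<in> borel_measurable (past k)"
      using gain_measurable_past measurable_past_iterates by auto
    show ?thesis unfolding W_def y_def by measurable
  qed
  have AW_int: "integrable M (\<lambda>\<omega>. W \<omega> * indicat_real (accepted k) \<omega>)"
    using integrable_real_mult_indicator[OF accepted_sets W_int] by simp
  have pW: "integrable M (\<lambda>\<omega>. W \<omega> * acceptance_prob k \<omega>)"
    "expectation (\<lambda>\<omega>. W \<omega> * acceptance_prob k \<omega>) = expectation (\<lambda>\<omega>. W \<omega> * indicat_real (accepted k) \<omega>)"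
    using H.real_cond_exp_intg[OF AW_int W_past] by auto
  have S_pos: "0 < norm (S k \<omega>)" if "\<omega> \<in> space M" for \<omega>
    using S[OF that] radius_bounds(1)[OF that, of k] \<rho> by (smt (verit) mult_pos_pos)
  have "AE \<omega> in M. a * norm (S k \<omega>) powr q < \<theta> * norm (S k \<omega>) powr q - gain k \<omega> \<longrightarrow>
    acceptance_prob k \<omega> * (\<theta> * norm (S k \<omega>) powr q - gain k \<omega>) \<le> a * norm (S k \<omega>) powr q"
    by (rule acceptance_prob_tail[OF a(1)]) (use S_pos dev in auto)
  then have "AE \<omega> in M. W \<omega> * acceptance_prob k \<omega> \<le> (m - c) * y \<omega>"
    using acceptance_prob_bounds[of k] AE_space
  proof eventually_elim
    case (elim \<omega>)
    then have \<omega>: "\<omega> \<in> space M" by simp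
    have "acceptance_prob k \<omega> * (T * y \<omega> - \<nu> * gain k \<omega>) \<le> (m - c) * y \<omega>"
    proof (rule drift_le[where z = "norm (S k \<omega>) powr q" and a = a and r = "\<rho> powr q" and \<theta> = \<theta>])
      have "\<rho> powr q * y \<omega> = (\<rho> * \<Delta> k \<omega>) powr q"
        using \<rho> radius_bounds[OF \<omega>, of k] by (simp add: y_def powr_mult)
      also have "\<dots> \<le> norm (S k \<omega>) powr q"
        using S[OF \<omega>] \<rho> radius_bounds[OF \<omega>, of k] q_gt_1 by (intro powr_mono2) auto
      finally show "\<rho> powr q * y \<omega> \<le> norm (S k \<omega>) powr q" .
      show "norm (S k \<omega>) powr q \<le> y \<omega>"
        using step_norm_le[OF \<omega>] q_gt_1 by (auto simp: y_def intro!: powr_mono2)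
      show "0 < norm (S k \<omega>) powr q" using S_pos[OF \<omega>] by simp
    qed (use elim a \<nu> c in \<open>auto simp: T_def m_def\<close>)
    then show ?case by (simp add: W_def mult.commute)
  qed
  then have decr: "expectation (\<lambda>\<omega>. W \<omega> * indicat_real (accepted k) \<omega>) \<le> (m - c) * expectation y"
    using integral_mono_AE[OF pW(1), of "\<lambda>\<omega>. (m - c) * y \<omega>"] y_int pW(2) by simp
  have "expectation (\<lambda>\<omega>. \<nu> * f (X (Suc k) \<omega>) + \<Delta> (Suc k) \<omega> powr q) \<le>
      expectation (\<lambda>\<omega>. \<nu> * f (X k \<omega>) + y \<omega> + W \<omega> * indicat_real (accepted k) \<omega> - m * y \<omega>)"
  proof (rule integral_mono)
    fix \<omega> assume "\<omega> \<in> space M"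
    then show "\<nu> * f (X (Suc k) \<omega>) + \<Delta> (Suc k) \<omega> powr q \<le>
        \<nu> * f (X k \<omega>) + y \<omega> + W \<omega> * indicat_real (accepted k) \<omega> - m * y \<omega>"
      using lyapunov_pathwise[of \<omega> \<nu> k] \<nu> by (simp add: W_def T_def m_def y_def mult.commute)
  qed (use int y_int AW_int in auto)
  then have "\<nu> * expectation (\<lambda>\<omega>. f (X (Suc k) \<omega>)) + expectation (\<lambda>\<omega>. \<Delta> (Suc k) \<omega> powr q)
    \<le> \<nu> * expectation (\<lambda>\<omega>. f (X k \<omega>)) + expectation y
      + expectation (\<lambda>\<omega>. W \<omega> * indicat_real (accepted k) \<omega>) - m * expectation y"
    using int y_int AW_int by simp
  then show ?thesis using decr by (simp add: y_def algebra_simps)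
qed

end

section \<open>Summability\<close>

lemma suminf_ennreal_finite_of_telescoping:
  fixes u v :: "nat \<Rightarrow> real"
  assumes u: "\<And>k. 0 \<le> u k" and c: "0 < c" and v: "\<And>k. L \<le> v k"
    and step: "\<And>k. v (Suc k) \<le> v k - c * u k"
  shows "(\<Sum>k. ennreal (u k)) < \<infinity>"
proof -
  have tele: "c * (\<Sum>k<n. u k) \<le> v 0 - v n" for n
  proof (induction n)
    case (Suc n)
    then show ?case using step[of n] by (simp add: distrib_left)
  qed simp
  have "(\<Sum>k<n. u k) \<le> (v 0 - L) / c" for n
    using tele[of n] v[of n] c by (simp add: pos_le_divide_eq mult.commute)
  then have "summable u" using u by (intro summableI_nonneg_bounded) auto
  then show ?thesis using u by (simp add: suminf_ennreal2)
qed

theorem theorem4p4: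
  fixes M :: "'w measure"
    and f :: "real ^ 'n \<Rightarrow> real"
    and x0 :: "real ^ 'n"
    and \<delta>0 \<theta> \<tau> \<tau>bar q \<rho> \<epsilon> :: real
    and X G S :: "nat \<Rightarrow> 'w \<Rightarrow> real ^ 'n"
    and B :: "nat \<Rightarrow> 'w \<Rightarrow> real ^ 'n ^ 'n"
    and \<Delta> F Fs :: "nat \<Rightarrow> 'w \<Rightarrow> real"
  assumes algorithm: "stochastic_trust_region M f x0 \<delta>0 \<theta> \<tau> \<tau>bar q X \<Delta> G B S F Fs"
    and \<rho>: "0 < \<rho>" "\<rho> \<le> 1"
    and B_bound: "\<And>k \<omega>. \<omega> \<in> space M \<Longrightarrow>
      onorm (\<lambda>v. B k \<omega> *v v) \<le> (1 / \<rho>) * (norm (G k \<omega>) / \<Delta> k \<omega>)"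
    and \<epsilon>: "\<epsilon> > 0"
    and tail_bound: "\<And>k \<alpha>. \<alpha> > 0 \<Longrightarrow>
      AE \<omega> in M. real_cond_exp M (tr_history M F Fs G B k)
        (indicat_real {w \<in> space M.
          \<bar>F k w - Fs k w - (f (X k w) - f (X k w + S k w))\<bar> \<ge> \<alpha> * norm (S k w) powr q}) \<omega>
        \<le> \<epsilon> / \<alpha> powr (q / (q - 1))"
    and \<theta>_bound: "\<theta> > (\<rho> powr q * tau_minus \<tau> q + tau_plus \<tau> q) * \<epsilon> powr (1 / (q / (q - 1)))
      / (\<rho> powr q * tau_minus \<tau> q)"
  shows "(\<Sum>k. \<integral>\<^sup>+ \<omega>. ennreal (\<Delta> k \<omega> powr q) \<partial>M) < \<infinity>"
proof -
  interpret stochastic_trust_region M f x0 \<delta>0 \<theta> \<tau> \<tau>bar q X \<Delta> G B S F Fs by (rule algorithm)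
  define r where "r = q / (q - 1)"
  define a where "a = \<epsilon> powr (1 / r)"
  have r: "1 \<le> r" using q_gt_1 by (simp add: r_def)
  have a: "0 < a" using \<epsilon> by (simp add: a_def)
  have dev: "AE \<omega> in M. real_cond_exp M (past k) (indicat_real (deviation k \<alpha>)) \<omega> \<le> a / \<alpha>"
    if "a < \<alpha>" for k \<alpha>
  proof -
    have "\<epsilon> / \<alpha> powr r \<le> a / \<alpha>"
      using powr_tail_le_linear_tail[OF \<epsilon> r, of \<alpha>] that by (simp add: a_def)
    then show ?thesis
      using tail_bound[of \<alpha> k] a that unfolding deviation_def r_def by auto
  qed
  have S: "\<rho> * \<Delta> k \<omega> \<le> norm (S k \<omega>)" if "\<omega> \<in> space M" for k \<omega>
    using that by (intro tr_step_norm_ge[OF B_symmetric S_argmin G_nonzero radius_bounds(1) \<rho> B_bound])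
  have \<rho>q: "0 < \<rho> powr q" "\<rho> powr q \<le> 1"
    using \<rho> q_gt_1 powr_mono2[of q \<rho> 1] by auto
  have minus: "0 < tau_minus \<tau> q"
    using \<tau>_bounds q_gt_1 powr_less_mono2[of q "1 - \<tau>" 1] by (simp add: tau_minus_def)
  have plus: "0 < tau_plus \<tau> q"
    using \<tau>_bounds q_gt_1 powr_less_mono2[of q 1 "1 + \<tau>"] by (simp add: tau_plus_def)
  obtain \<nu> c where \<nu>: "0 < \<nu>" and c: "0 < c" and a\<theta>: "a < \<theta>"
    and bounds: "c \<le> \<nu> * \<rho> powr q * (\<theta> - a) - tau_plus \<tau> q" "c \<le> tau_minus \<tau> q - \<nu> * a"
      "c * \<theta> \<le> tau_minus \<tau> q * \<theta> - a * (tau_plus \<tau> q + tau_minus \<tau> q)"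
    using lyapunov_weight_exists[of "\<rho> powr q" "tau_minus \<tau> q" "tau_plus \<tau> q + tau_minus \<tau> q" a \<theta>]
      \<rho>q minus plus a \<theta>_bound by (auto simp: a_def r_def)
  obtain L where L: "\<And>x. L \<le> f x" using f_bdd_below by (auto simp: bdd_below_def)
  define u where "u = (\<lambda>k. expectation (\<lambda>\<omega>. \<Delta> k \<omega> powr q))"
  define v where "v = (\<lambda>k. \<nu> * expectation (\<lambda>\<omega>. f (X k \<omega>)) + u k)"
  have u: "0 \<le> u k" for k by (simp add: u_def)
  have v: "\<nu> * L \<le> v k" for k
  proof -
    have "L \<le> expectation (\<lambda>\<omega>. f (X k \<omega>))"
      using integral_ge_const[OF integrable_objective] L by auto
    then have "\<nu> * L \<le> \<nu> * expectation (\<lambda>\<omega>. f (X k \<omega>))" using \<nu> by simp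
    then show ?thesis using u[of k] by (simp add: v_def)
  qed
  have step: "v (Suc k) \<le> v k - c * u k" for k
    using lyapunov_expected_decrease[OF \<rho>(1) S dev a a\<theta> \<nu> bounds] by (simp add: v_def u_def)
  have "(\<Sum>k. ennreal (u k)) < \<infinity>"
    using u c v step by (rule suminf_ennreal_finite_of_telescoping)
  moreover have "(\<integral>\<^sup>+ \<omega>. ennreal (\<Delta> k \<omega> powr q) \<partial>M) = ennreal (u k)" for k
    unfolding u_def by (rule nn_integral_eq_integral[OF integrable_radius_powr]) simp
  ultimately show ?thesis by simp
qed

end
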